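(* Let $\mathbf{x}\in\mathbb{R}^d$, $\epsilon\sim\mathcal{N}(0,\sigma^2 I)$, $l\in\{1,2,\dots,c\}$, and let $\underline{p_l},\overline{p}_1,\dots,\overline{p}_{l-1},\overline{p}_{l+1},\dots,\overline{p}_c\in[0,1]$. Let $\overline{p}_{b_k}\ge\overline{p}_{b_{k-1}}\ge\cdots\ge\overline{p}_{b_1}$ be the $k$ largest ones among $\{\overline{p}_i: i\ne l\}$, where ties are broken uniformly at random, and for $t=1,\dots,k$ let $S_t=\{b_1,\dots,b_t\}$ and $\overline{p}_{S_t}=\sum_{j=1}^t\overline{p}_{b_j}$. Let $R_l$ be the unique solution to the equation $$\Phi\Big(\Phi^{-1}(\underline{p_l})-\frac{R_l}{\sigma}\Big)-\min_{1\le t\le k}\frac{\Phi\big(\Phi^{-1}(\overline{p}_{S_t})+\frac{R_l}{\sigma}\big)}{t}=0.$$ Assume $$\underline{p_l}+\sum_{j=1}^k\overline{p}_{b_j}\le 1\quad\text{and}\quad \underline{p_l}+\sum_{i\in\{1,\dots,c\},\, i\ne l}\overline{p}_i\ge 1 .$$ Then, for any perturbation $\delta\in\mathbb{R}^d$ with $\|\delta\|_2>R_l$, there exists a base classifier $f^*:\mathbb{R}^d\to\{1,\dots,c\}$ satisfying $$\Pr(f^*(\mathbf{x}+\epsilon)=l)\ge \underline{p_l}\quad\text{and}\quad \Pr(f^*(\mathbf{x}+\epsilon)=i)\le\overline{p}_i\ \ \forall i\ne l,$$ but for which $l\notin g_k(\mathbf{x}+\delta)$, where $g_k$ is the smoothed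 classifier of $f^*$.
   Context: $\sigma>0$ is the noise standard deviation, $c$ is the number of labels and $k$ is the number of predicted labels. $\Phi$ and $\Phi^{-1}$ are the cumulative distribution function of the standard Gaussian distribution on $\mathbb{R}$ and its inverse. For a base classifier $f$ and a point $\mathbf{z}\in\mathbb{R}^d$, the smoothed classifier $g_k(\mathbf{z})$ returns the set of the $k$ labels $i\in\{1,\dots,c\}$ with the largest probabilities $\Pr(f(\mathbf{z}+\epsilon)=i)$, where $\epsilon\sim\mathcal{N}(0,\sigma^2 I)$. *)

theory Defs
  imports "HOL-Probability.Probability"
begin

(* The Gaussian N(0, s^2 I): independent coordinates, each with density normal_density 0 s. *)
definition isotropic_gaussian :: "real \<Rightarrow> 'a::euclidean_space measure" where
  "isotropic_gaussian s = density lborel (\<lambda>e. ennreal (\<Prod>b\<in>Basis. normal_density 0 s (e \<bullet> b)))"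

definition label_prob :: "real \<Rightarrow> ('a::euclidean_space \<Rightarrow> nat) \<Rightarrow> 'a \<Rightarrow> nat \<Rightarrow> real" where
  "label_prob s f z i = measure (isotropic_gaussian s) {e. f (z + e) = i}"

(* "The k labels with the largest probabilities" is ambiguous in case of ties; this is the
   set of all admissible outputs of the smoothed classifier, one for each way to break ties. *)
definition smoothed_topk ::
    "nat \<Rightarrow> nat \<Rightarrow> real \<Rightarrow> ('a::euclidean_space \<Rightarrow> nat) \<Rightarrow> 'a \<Rightarrow> nat set set" where
  "smoothed_topk c k s f z =
     {G. G \<subseteq> {1..c} \<and> card G = k \<and>
         (\<forall>i\<in>G. \<forall>j\<in>{1..c} - G. label_prob s f z j \<le> label_prob s f z i)}"

(* b enumerates, in increasing order of p and for some way to break ties,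
   k largest ones among the values p i with i in I. *)
definition k_largest :: "nat set \<Rightarrow> (nat \<Rightarrow> real) \<Rightarrow> nat \<Rightarrow> (nat \<Rightarrow> nat) \<Rightarrow> bool" where
  "k_largest I p k b \<longleftrightarrow>
     inj_on b {1..k} \<and> b ` {1..k} \<subseteq> I \<and>
     (\<forall>s\<in>{1..k}. \<forall>t\<in>{1..k}. s \<le> t \<longrightarrow> p (b s) \<le> p (b t)) \<and>
     (\<forall>i \<in> I - b ` {1..k}. \<forall>t\<in>{1..k}. p i \<le> p (b t))"

(* The standard Gaussian cdf on the extended reals, so that its inverse is defined on
   all of [0,1], including the end points. *)
definition Phi :: "ereal \<Rightarrow> real" where
  "Phi z = (case z of ereal r \<Rightarrow> cdf std_normal_distribution r | PInfty \<Rightarrow> 1 | MInfty \<Rightarrow> 0)"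

definition Phi_inv :: "real \<Rightarrow> ereal" where
  "Phi_inv = inv Phi"

definition radius_gap :: "nat \<Rightarrow> real \<Rightarrow> real \<Rightarrow> (nat \<Rightarrow> real) \<Rightarrow> real \<Rightarrow> real" where
  "radius_gap k s pl pS R =
     Phi (Phi_inv pl - ereal (R / s)) -
     (MIN t\<in>{1..k}. Phi (Phi_inv (pS t) + ereal (R / s)) / real t)"

lemma prob_space_isotropic_gaussian:
  assumes "s > 0"
  shows "prob_space (isotropic_gaussian s :: 'a::euclidean_space measure)"
proof
  have "(\<integral>\<^sup>+ x. ennreal (normal_density 0 s x) \<partial>lborel) = 1"
  proof -
    interpret prob_space "density lborel (normal_density 0 s)"
      using assms by (rule prob_space_normal_density)
    show ?thesis
      using emeasure_space_1 by (simp add: emeasure_density)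
  qed
  moreover have "(\<integral>\<^sup>+ x. ennreal (\<Prod>b\<in>(Basis::'a set). normal_density 0 s (x \<bullet> b)) \<partial>lborel)
      = (\<Prod>b\<in>(Basis::'a set). (\<integral>\<^sup>+ x. ennreal (normal_density 0 s x) \<partial>lborel))"
    by (subst nn_integral_lborel_prod [symmetric]) (simp_all add: prod_ennreal)
  ultimately show "emeasure (isotropic_gaussian s) (space (isotropic_gaussian s :: 'a measure)) = 1"
    by (simp add: isotropic_gaussian_def emeasure_density)
qed

lemma smoothed_topk_nonempty:
  assumes "k \<le> c"
  shows "smoothed_topk c k s f z \<noteq> {}"
proof -
  let ?P = "label_prob s f z"
  have "\<exists>G. G \<subseteq> {1..c} \<and> card G = k \<and> (\<forall>i\<in>G. \<forall>j\<in>{1..c} - G. ?P j \<le> ?P i)"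
    using assms
  proof (induction k)
    case 0
    show ?case by (intro exI [of _ "{}"]) simp
  next
    case (Suc k)
    then obtain G where G: "G \<subseteq> {1..c}" "card G = k"
      "\<forall>i\<in>G. \<forall>j\<in>{1..c} - G. ?P j \<le> ?P i" by auto
    have fin: "finite G" using G(1) finite_subset by blast
    have "{1..c} - G \<noteq> {}"
    proof
      assume "{1..c} - G = {}"
      then have "card {1..c} \<le> card G" using fin by (intro card_mono) auto
      then show False using G(2) Suc.prems by simp
    qed
    moreover have "finite ({1..c} - G)" by simp
    ultimately obtain m where m: "m \<in> {1..c} - G" "\<forall>j\<in>{1..c} - G. ?P j \<le> ?P m"
      using Max_in [of "?P ` ({1..c} - G)"] Max_ge [of "?P ` ({1..c} - G)"] by fastforce
    then show ?case
      using G fin by (intro exI [of _ "insert m G"]) auto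
  qed
  then show ?thesis by (auto simp: smoothed_topk_def)
qed

lemma std_normal_cdf_strict_mono: "strict_mono (cdf std_normal_distribution)"
proof (rule strict_monoI)
  interpret real_distribution std_normal_distribution by (rule real_dist_normal_dist)
  fix x y :: real
  assume xy: "x < y"
  have "measure std_normal_distribution {x<..y} \<noteq> 0"
  proof
    assume "measure std_normal_distribution {x<..y} = 0"
    then have "emeasure std_normal_distribution {x<..y} = 0"
      by (simp add: emeasure_eq_measure)
    then have "(\<integral>\<^sup>+ z. ennreal (std_normal_density z) * indicator {x<..y} z \<partial>lborel) = 0"
      by (simp add: emeasure_density)
    then have "AE z in lborel. ennreal (std_normal_density z) * indicator {x<..y} z = 0"
      by (subst (asm) nn_integral_0_iff_AE) simp_all
    moreover have pos: "\<not> std_normal_density z \<le> 0" for z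
      by (simp add: not_le normal_density_pos)
    ultimately have "AE z in lborel. z \<notin> {x<..y}"
      by (auto simp: indicator_def ennreal_eq_0_iff pos elim!: eventually_mono split: if_splits)
    then have "emeasure lborel {x<..y} = 0"
      by (subst (asm) AE_iff_measurable [of "{x<..y}"]) auto
    then show False using xy by simp
  qed
  then show "cdf std_normal_distribution x < cdf std_normal_distribution y"
    using cdf_diff_eq [OF xy] measure_nonneg [of std_normal_distribution "{x<..y}"] by linarith
qed

lemma bij_betw_Phi: "bij_betw Phi UNIV {0..1}"
proof -
  let ?F = "cdf std_normal_distribution"
  interpret real_distribution std_normal_distribution by (rule real_dist_normal_dist)
  have sm: "x < y \<Longrightarrow> ?F x < ?F y" for x y
    using std_normal_cdf_strict_mono by (simp add: strict_mono_def)
  have pos: "0 < ?F x" for x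
    using sm [of "x - 1" x] cdf_nonneg [of "x - 1"] by simp
  have lt1: "?F x < 1" for x
    using sm [of x "x + 1"] cdf_bounded_prob [of "x + 1"] by simp
  have inj: "inj Phi"
  proof (rule injI)
    fix x y assume "Phi x = Phi y"
    then show "x = y"
      using pos lt1 sm
      by (cases x; cases y; simp add: Phi_def) (metis less_irrefl linorder_less_linear)+
  qed
  have cont: "isCont ?F x" for x
  proof -
    have "emeasure std_normal_distribution {x} = 0"
      by (subst emeasure_density) (auto intro: nn_integral_null_set simp: null_sets_def)
    then show ?thesis by (simp add: isCont_cdf measure_def)
  qed
  have "p \<in> range Phi" if p: "0 \<le> p" "p \<le> 1" for p
  proof -
    consider "p = 0" | "p = 1" | "0 < p" "p < 1" using p by linarith
    then show ?thesis
    proof cases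
      case 1
      then have "Phi (-\<infinity>) = p" by (simp add: Phi_def)
      then show ?thesis by blast
    next
      case 2
      then have "Phi \<infinity> = p" by (simp add: Phi_def)
      then show ?thesis by blast
    next
      case 3
      obtain a where a: "?F a < p"
        using order_tendstoD(2) [OF cdf_lim_at_bot 3(1)] eventually_happens by force
      obtain b where b: "p < ?F b"
        using order_tendstoD(1) [OF cdf_lim_at_top_prob 3(2)] eventually_happens by force
      have "a \<le> b" using a b cdf_nondecreasing [of b a] by linarith
      then obtain r where "?F r = p"
        using IVT [of ?F a p b] a b cont by auto
      then have "Phi (ereal r) = p" by (simp add: Phi_def)
      then show ?thesis by blast
    qed
  qed
  moreover have "Phi x \<in> {0..1}" for x
    using pos lt1 by (cases x) (auto simp: Phi_def less_imp_le)
  ultimately have "range Phi = {0..1}" by auto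
  then show ?thesis using inj by (simp add: bij_betw_def)
qed

end

theory Submission
  imports Defs
begin

text \<open>
  Only the coordinate $y = \langle z - x, \delta\rangle / (\sigma \|\delta\|)$ of a point $z$
  matters: it is distributed as $N(0,1)$ around $x$ and as $N(\tau,1)$ around $x + \delta$, where
  $\tau = \|\delta\|/\sigma$. Label $l$ is placed on the lower tail of mass $\underline{p_l}$ and
  the labels $b_1,\dots,b_k$ on the upper tail of mass $\overline{p}_{S_k}$; the remaining labels share
  the gap between the two. Beyond the radius, $l$ has probability less than $q$ around $x + \delta$, where
  $q$ is the minimum over $t$ of the $N(\tau,1)$-mass of the upper tail of $N(0,1)$-mass
  $\overline{p}_{S_t}$ divided by $t$. The upper tail can be cut so that each $b_j$ has
  $N(0,1)$-mass exactly $\overline{p}_{b_j}$ and $N(\tau,1)$-mass at least $q$. Hence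
  each of $b_1,\dots,b_k$ beats $l$.
\<close>

section \<open>The extended Gaussian distribution function\<close>

text \<open>A monotone function can only be discontinuous by jumping over values, and surjectivity
  excludes jumps.\<close>

lemma continuous_on_mono_onto_unit_interval:
  fixes g :: "real \<Rightarrow> real"
  assumes mono: "\<And>x y. 0 \<le> x \<Longrightarrow> x \<le> y \<Longrightarrow> y \<le> 1 \<Longrightarrow> g x \<le> g y"
    and onto: "g ` {0..1} = {0..1}"
  shows "continuous_on {0..1} g"
proof -
  \<comment> \<open>\<open>continuous_onI_mono\<close> asks for an open image. Extending
    \<open>g\<close> by the identity keeps monotonicity, as \<open>g\<close> stays within the unit
    interval, and makes the image the whole line.\<close>
  define h where "h = (\<lambda>x. if x \<in> {0..1} then g x else x)"
  have gr: "0 \<le> g x" "g x \<le> 1" if "x \<in> {0..1}" for x using onto that by auto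
  have "range h = UNIV"
  proof (intro set_eqI iffI UNIV_I)
    fix y :: real
    show "y \<in> range h"
    proof (cases "y \<in> {0..1}")
      case True
      then obtain x where "x \<in> {0..1}" "g x = y" using onto by (metis imageE)
      then show ?thesis by (intro range_eqI[of _ _ x]) (simp add: h_def)
    next
      case False
      then have "h y = y" unfolding h_def by (rule if_not_P)
      then show ?thesis by (metis rangeI)
    qed
  qed
  moreover have "h x \<le> h y" if "x \<le> y" for x y
    using that mono[of x y] gr[of x] gr[of y] by (auto simp: h_def)
  ultimately have "continuous_on UNIV h" by (intro continuous_onI_mono) auto
  then have "continuous_on {0..1} h" by (rule continuous_on_subset) simp
  then show ?thesis by (rule continuous_on_cong[THEN iffD1, rotated -1]) (auto simp: h_def)
qed

lemma Phi_Phi_inv: "p \<in> {0..1} \<Longrightarrow> Phi (Phi_inv p) = p"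
  unfolding Phi_inv_def using bij_betw_Phi by (intro f_inv_into_f) (auto simp: bij_betw_def)

lemma Phi_inv_Phi: "Phi_inv (Phi z) = z"
  unfolding Phi_inv_def using bij_betw_Phi by (intro inv_f_f) (auto simp: bij_betw_def)

lemma Phi_range: "Phi z \<in> {0..1}"
  using bij_betw_Phi by (auto simp: bij_betw_def)

lemma Phi_mono: "x \<le> y \<Longrightarrow> Phi x \<le> Phi y"
  using Phi_range[of x] Phi_range[of y] std_normal_cdf_strict_mono
  by (cases x; cases y) (auto simp: Phi_def strict_mono_less_eq)

lemma Phi_less: "x < y \<Longrightarrow> Phi x < Phi y"
  using Phi_mono[of x y] Phi_inv_Phi by (metis less_le)

lemma Phi_inv_mono: "p \<in> {0..1} \<Longrightarrow> q \<in> {0..1} \<Longrightarrow> p \<le> q \<Longrightarrow> Phi_inv p \<le> Phi_inv q"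
  using Phi_less[of "Phi_inv q" "Phi_inv p"] by (force simp: Phi_Phi_inv)

lemma Phi_0: "Phi (-\<infinity>) = 0" and Phi_1: "Phi \<infinity> = 1"
  by (auto simp: Phi_def)

lemma Phi_inv_0: "Phi_inv 0 = -\<infinity>"
  using Phi_inv_Phi[of "-\<infinity>"] by (simp add: Phi_0)

text \<open>The function sends the N(0,1)-mass of an upper tail to its N(a,1)-mass. Arguing by
  monotonicity and surjectivity covers the end points, where \<open>Phi_inv\<close> is infinite,
  without separate limits.\<close>

lemma continuous_on_Phi_shift: "continuous_on {0..1} (\<lambda>m. Phi (Phi_inv m + ereal a))"
proof (rule continuous_on_mono_onto_unit_interval)
  show "Phi (Phi_inv x + ereal a) \<le> Phi (Phi_inv y + ereal a)"
    if "0 \<le> x" "x \<le> y" "y \<le> 1" for x y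
    using that by (intro Phi_mono add_right_mono Phi_inv_mono) auto
  show "(\<lambda>m. Phi (Phi_inv m + ereal a)) ` {0..1} = {0..1}"
  proof (intro equalityI subsetI)
    fix y :: real
    assume y: "y \<in> {0..1}"
    have "Phi_inv y - ereal a + ereal a = Phi_inv y" by (cases "Phi_inv y") auto
    then have "Phi (Phi_inv (Phi (Phi_inv y - ereal a)) + ereal a) = y"
      using y by (simp add: Phi_inv_Phi Phi_Phi_inv)
    then show "y \<in> (\<lambda>m. Phi (Phi_inv m + ereal a)) ` {0..1}"
      using Phi_range[of "Phi_inv y - ereal a"] by (metis imageI)
  qed (use Phi_range in auto)
qed

abbreviation unit_normal :: "real \<Rightarrow> real measure" where
  "unit_normal a \<equiv> density lborel (normal_density a 1)"

text \<open>Both signs of \<open>c\<close> are used: \<open>c = 1\<close> shifts lower tails,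
  \<open>c = -1\<close> reflects upper tails into lower ones, so that either becomes a value of the
  standard cdf.\<close>

lemma measure_unit_normal_affine:
  assumes S: "S \<in> sets borel" and c: "\<bar>c\<bar> = 1"
  shows "measure (unit_normal a) S = measure std_normal_distribution {y. a + c * y \<in> S}"
proof -
  interpret prob_space std_normal_distribution
    by (rule prob_space_normal_density) simp
  have "distributed std_normal_distribution lborel (\<lambda>y. y) std_normal_density"
    unfolding distributed_def by (auto simp: distr_id2)
  then have "distributed std_normal_distribution lborel (\<lambda>y. a + c * y) (normal_density a 1)"
    using normal_density_affine[of "\<lambda>y. y" 0 1 c a] c by auto
  then have "measure (unit_normal a) S = measure (distr std_normal_distribution lborel (\<lambda>y. a + c * y)) S"
    by (simp add: distributed_distr_eq_density)
  also have "\<dots> = measure std_normal_distribution {y. a + c * y \<in> S}"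
    using S by (subst measure_distr) (auto simp: vimage_def)
  finally show ?thesis .
qed

text \<open>Reflecting by y to a - y turns the upper tail into a lower one. The threshold is
  \<open>- z\<close> so that \<open>z = Phi_inv m\<close> yields mass \<open>m\<close> at
  \<open>a = 0\<close> and a term of the radius equation in general; infinite \<open>z\<close> gives
  the empty set or the whole line.\<close>

lemma measure_unit_normal_ge: "measure (unit_normal a) {y. - z \<le> ereal y} = Phi (z + ereal a)"
proof -
  interpret prob_space std_normal_distribution
    by (rule prob_space_normal_density) simp
  have m: "{y. - z \<le> ereal y} \<in> sets borel" by measurable
  have "measure (unit_normal a) {y. - z \<le> ereal y} =
      measure std_normal_distribution {y. - z \<le> ereal (a - y)}"
    using measure_unit_normal_affine[OF m, of "-1" a] by simp
  also have "\<dots> = Phi (z + ereal a)"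
  proof (cases z)
    case (real r)
    then have "{y. - z \<le> ereal (a - y)} = {..r + a}" by auto
    then show ?thesis using real by (simp add: Phi_def cdf_def)
  next
    case PInf
    then show ?thesis using prob_space by (simp add: Phi_def)
  qed (simp add: Phi_def)
  finally show ?thesis .
qed

text \<open>The inequality is strict because this set will be the complement of a closed upper tail.
  The boundary point is a null set, so the cdf still applies.\<close>

lemma measure_unit_normal_less: "measure (unit_normal a) {y. ereal y < z} = Phi (z - ereal a)"
proof -
  interpret prob_space "unit_normal a"
    by (rule prob_space_normal_density) simp
  interpret S: prob_space std_normal_distribution
    by (rule prob_space_normal_density) simp
  have m: "{y. ereal y \<le> z} \<in> sets borel" by measurable
  have "measure (unit_normal a) {y. ereal y < z} = measure (unit_normal a) {y. ereal y \<le> z}"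
  proof (cases z)
    case (real r)
    have "AE y in unit_normal a. (y \<in> {y. ereal y < z}) = (y \<in> {y. ereal y \<le> z})"
      using AE_lborel_singleton[of r] real by (auto simp: AE_density elim!: eventually_mono)
    then show ?thesis using m by (intro finite_measure_eq_AE) auto
  qed auto
  also have "\<dots> = measure std_normal_distribution {y. ereal (a + y) \<le> z}"
    using measure_unit_normal_affine[OF m, of 1 a] by simp
  also have "\<dots> = Phi (z - ereal a)"
  proof (cases z)
    case (real r)
    then have "{y. ereal (a + y) \<le> z} = {..r - a}" by auto
    then show ?thesis using real by (simp add: Phi_def cdf_def)
  next
    case PInf
    then show ?thesis using S.prob_space by (simp add: Phi_def)
  qed (simp add: Phi_def)
  finally show ?thesis .
qed

text \<open>The upper tail from \<open>- z\<close> has mass \<open>Phi z\<close>, and its complement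
  is the lower tail of mass \<open>Phi (- z)\<close>.\<close>

lemma Phi_uminus: "Phi (- z) = 1 - Phi z"
proof -
  interpret prob_space std_normal_distribution
    by (rule prob_space_normal_density) simp
  have "{y. - z \<le> ereal y} = space std_normal_distribution - {y. ereal y < - z}" by auto
  moreover have "{y. ereal y < - z} \<in> sets borel" by measurable
  ultimately have "measure std_normal_distribution {y. - z \<le> ereal y} =
     1 - measure std_normal_distribution {y. ereal y < - z}"
    using prob_compl[of "{y. ereal y < - z}"] by simp
  then show ?thesis
    using measure_unit_normal_ge[of 0 z] measure_unit_normal_less[of 0 "- z"] 
    by (simp flip: zero_ereal_def)
qed

lemma Phi_inv_one_minus: "p \<in> {0..1} \<Longrightarrow> Phi_inv (1 - p) = - Phi_inv p"
  using Phi_inv_Phi[of "- Phi_inv p"] by (simp add: Phi_uminus Phi_Phi_inv)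

section \<open>Projections of the isotropic Gaussian\<close>

lemma nn_integral_normal_density:
  assumes "s > 0"
  shows "(\<integral>\<^sup>+ x. ennreal (normal_density m s x) \<partial>lborel) = 1"
proof -
  interpret prob_space "density lborel (normal_density m s)"
    using assms by (rule prob_space_normal_density)
  show ?thesis
    using emeasure_space_1 by (simp add: emeasure_density)
qed

text \<open>Density and indicator of the cylinder are both products over \<open>Basis\<close>, so
  the integral factors; coordinates outside \<open>J\<close> contribute 1. Singletons
  \<open>J\<close> give the marginals, general \<open>J\<close> the independence of the
  coordinates.\<close>

lemma emeasure_isotropic_gaussian_coordinates:
  fixes A :: "'a::euclidean_space \<Rightarrow> real set"
  assumes s: "s > 0" and J: "J \<subseteq> Basis" and A[measurable]: "\<And>b. b \<in> J \<Longrightarrow> A b \<in> sets borel"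
  shows "emeasure (isotropic_gaussian s) {e. \<forall>b\<in>J. e \<bullet> b \<in> A b} =
    (\<Prod>b\<in>J. emeasure (density lborel (normal_density 0 s)) (A b))"
proof -
  let ?N = "\<lambda>r. ennreal (normal_density 0 s r)"
  have fin[simp]: "finite J" using J by (rule finite_subset) simp
  define g where "g = (\<lambda>b r. ?N r * (if b \<in> J then indicator (A b) r else 1))"
  have g[measurable]: "g b \<in> borel_measurable borel" for b
    by (cases "b \<in> J") (auto simp: g_def)
  have m: "{e::'a. \<forall>b\<in>J. e \<bullet> b \<in> A b} \<in> sets borel"
  proof -
    have "{e::'a. \<forall>b\<in>J. e \<bullet> b \<in> A b} = (\<Inter>b\<in>J. (\<lambda>e. e \<bullet> b) -` A b) \<inter> UNIV" by auto
    moreover have "(\<lambda>e::'a. e \<bullet> b) -` A b \<in> sets borel" if "b \<in> J" for b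
      using measurable_sets[of "\<lambda>e::'a. e \<bullet> b" borel borel "A b"] A[OF that] by simp
    ultimately show ?thesis
      by (cases "J = {}") (auto intro!: sets.finite_INT)
  qed
  have ind: "(\<Prod>b\<in>(Basis::'a set). (if b \<in> J then indicator (A b) (e \<bullet> b) else (1::ennreal)))
      = indicator {e. \<forall>b\<in>J. e \<bullet> b \<in> A b} e" for e
  proof -
    have "(\<Prod>b\<in>(Basis::'a set). (if b \<in> J then indicator (A b) (e \<bullet> b) else (1::ennreal)))
       = (\<Prod>b\<in>J. indicator (A b) (e \<bullet> b))"
      using J by (simp add: prod.If_cases Int_absorb1)
    also have "\<dots> = indicator {e. \<forall>b\<in>J. e \<bullet> b \<in> A b} e"
      by (auto simp: indicator_def prod_zero_iff)
    finally show ?thesis .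
  qed
  have "emeasure (isotropic_gaussian s) {e::'a. \<forall>b\<in>J. e \<bullet> b \<in> A b}
    = (\<integral>\<^sup>+ e. (\<Prod>b\<in>Basis. g b (e \<bullet> b)) \<partial>lborel)"
    unfolding isotropic_gaussian_def using m
    by (subst emeasure_density)
       (auto simp: g_def prod.distrib ind prod_ennreal intro!: nn_integral_cong)
  also have "\<dots> = (\<Prod>b\<in>Basis. (\<integral>\<^sup>+ r. g b r \<partial>lborel))"
    by (rule nn_integral_lborel_prod) auto
  also have "\<dots> = (\<Prod>b\<in>Basis. if b \<in> J then emeasure (density lborel (normal_density 0 s)) (A b) else 1)"
    using nn_integral_normal_density[OF s]
    by (intro prod.cong refl) (auto simp: g_def emeasure_density)
  also have "\<dots> = (\<Prod>b\<in>J. emeasure (density lborel (normal_density 0 s)) (A b))"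
    using J by (simp add: prod.If_cases Int_absorb1)
  finally show ?thesis .
qed

lemma sets_space_isotropic_gaussian[simp]:
  "sets (isotropic_gaussian s) = sets borel" "space (isotropic_gaussian s) = UNIV"
  by (auto simp: isotropic_gaussian_def)

lemma measurable_from_isotropic_gaussian[simp]:
  "measurable (isotropic_gaussian s) N = measurable borel N"
  by (rule measurable_cong_sets) simp_all

lemma distributed_isotropic_gaussian_coordinate:
  fixes b :: "'a::euclidean_space"
  assumes s: "s > 0" and b: "b \<in> Basis"
  shows "distributed (isotropic_gaussian s) lborel (\<lambda>e. e \<bullet> b) (normal_density 0 s)"
  unfolding distributed_def
proof (intro conjI)
  show "distr (isotropic_gaussian s) lborel (\<lambda>e. e \<bullet> b) = density lborel (normal_density 0 s)"
  proof (rule measure_eqI)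
    fix S :: "real set"
    assume S: "S \<in> sets (distr (isotropic_gaussian s) lborel (\<lambda>e. e \<bullet> b))"
    then have [measurable]: "S \<in> sets borel" by simp
    have "emeasure (isotropic_gaussian s) {e. e \<bullet> b \<in> S} =
        emeasure (density lborel (normal_density 0 s)) S"
      using emeasure_isotropic_gaussian_coordinates[OF s, of "{b}" "\<lambda>_. S"] b by simp
    then show "emeasure (distr (isotropic_gaussian s) lborel (\<lambda>e. e \<bullet> b)) S =
        emeasure (density lborel (normal_density 0 s)) S"
      by (subst emeasure_distr) (auto simp: vimage_def)
  qed simp
qed auto

lemma indep_vars_isotropic_gaussian:
  assumes s: "s > 0"
  shows "prob_space.indep_vars (isotropic_gaussian s) (\<lambda>_. borel)
    (\<lambda>b e. e \<bullet> b) (Basis :: 'a::euclidean_space set)"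
proof -
  interpret prob_space "isotropic_gaussian s :: 'a measure"
    using s by (rule prob_space_isotropic_gaussian)
  let ?N = "density lborel (normal_density 0 s)"
  show ?thesis
    unfolding indep_vars_def2
  proof (intro conjI ballI)
    show "indep_sets (\<lambda>b. {(\<lambda>e. e \<bullet> b) -` A \<inter> space (isotropic_gaussian s) |A. A \<in> sets borel})
      (Basis :: 'a set)"
    proof (rule indep_setsI)
      fix S :: "'a \<Rightarrow> 'a set" and J :: "'a set"
      assume J: "J \<noteq> {}" "J \<subseteq> Basis" "finite J"
        and "\<forall>j\<in>J. S j \<in> {(\<lambda>e. e \<bullet> j) -` A \<inter> space (isotropic_gaussian s) |A. A \<in> sets borel}"
      then have "\<forall>j\<in>J. \<exists>A. A \<in> sets borel \<and> S j = {e. e \<bullet> j \<in> A}"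
        by (fastforce simp: vimage_def)
      then obtain A where A: "\<And>j. j \<in> J \<Longrightarrow> A j \<in> sets borel"
        "\<And>j. j \<in> J \<Longrightarrow> S j = {e. e \<bullet> j \<in> A j}" by metis
      have 1: "(\<Inter>j\<in>J. S j) = {e. \<forall>b\<in>J. e \<bullet> b \<in> A b}" using A by auto
      have 2: "emeasure (isotropic_gaussian s) (S j) = emeasure ?N (A j)" if "j \<in> J" for j
        using emeasure_isotropic_gaussian_coordinates[OF s, of "{j}" A] A that J by auto
      have "emeasure (isotropic_gaussian s) (\<Inter>j\<in>J. S j) =
          (\<Prod>j\<in>J. emeasure (isotropic_gaussian s) (S j))"
        unfolding 1 using emeasure_isotropic_gaussian_coordinates[OF s J(2) A(1)] 2 by simp
      then show "prob (\<Inter>j\<in>J. S j) = (\<Prod>j\<in>J. prob (S j))"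
        by (simp add: emeasure_eq_measure prod_ennreal prod_nonneg)
    next
      show "{(\<lambda>e. e \<bullet> b) -` A \<inter> space (isotropic_gaussian s) |A. A \<in> sets borel} \<subseteq> events" for b :: 'a
        using measurable_sets[of "\<lambda>e. e \<bullet> b" borel borel] by fastforce
    qed
  qed auto
qed

text \<open>This is rotation invariance in the form needed: \<open>e \<bullet> u\<close> is a sum of
  independent centred normals with variances \<open>(u \<bullet> b)\<^sup>2 * s\<^sup>2\<close>,
  which add up to the square of \<open>s\<close> since \<open>u\<close> is a unit vector.\<close>

lemma distributed_isotropic_gaussian_inner:
  fixes u :: "'a::euclidean_space"
  assumes s: "s > 0" and u: "norm u = 1"
  shows "distributed (isotropic_gaussian s) lborel (\<lambda>e. e \<bullet> u) (normal_density 0 s)"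
proof -
  interpret prob_space "isotropic_gaussian s :: 'a measure"
    using s by (rule prob_space_isotropic_gaussian)
  \<comment> \<open>Coordinates with \<open>u \<bullet> b = 0\<close> are left out: their terms
    would be degenerate, while the lemmas on normal densities require a positive standard
    deviation.\<close>
  define B where "B = {b\<in>Basis. u \<bullet> b \<noteq> 0}"
  have [simp]: "finite B" by (simp add: B_def)
  have ne: "B \<noteq> {}"
  proof
    assume "B = {}"
    then have "u \<bullet> b = 0" if "b \<in> Basis" for b using that unfolding B_def by blast
    then show False using u by (metis euclidean_all_zero_iff norm_zero zero_neq_one)
  qed
  have sq: "(\<Sum>b\<in>B. (u \<bullet> b)\<^sup>2) = 1"
  proof -
    have "(\<Sum>b\<in>B. (u \<bullet> b)\<^sup>2) = (\<Sum>b\<in>Basis. (u \<bullet> b)\<^sup>2)"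
      by (rule sum.mono_neutral_left) (auto simp: B_def)
    also have "\<dots> = u \<bullet> u" by (subst euclidean_inner) (simp add: power2_eq_square)
    also have "\<dots> = 1" using u by (simp add: norm_eq_1)
    finally show ?thesis .
  qed
  have "indep_vars (\<lambda>_. borel) (\<lambda>b e. e \<bullet> b) B"
    by (rule indep_vars_subset[OF indep_vars_isotropic_gaussian[OF s]]) (auto simp: B_def)
  then have ind: "indep_vars (\<lambda>_. borel) (\<lambda>b e. (u \<bullet> b) * (e \<bullet> b)) B"
    by (rule indep_vars_compose2[where Y = "\<lambda>b r. (u \<bullet> b) * r"]) simp
  have d: "distributed (isotropic_gaussian s) lborel (\<lambda>e. (u \<bullet> b) * (e \<bullet> b))
     (normal_density 0 (\<bar>u \<bullet> b\<bar> * s))" if "b \<in> B" for b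
    using normal_density_affine[OF distributed_isotropic_gaussian_coordinate[OF s] s, of b "u \<bullet> b" 0] that
    by (auto simp: B_def)
  have "distributed (isotropic_gaussian s) lborel (\<lambda>e. \<Sum>b\<in>B. (u \<bullet> b) * (e \<bullet> b))
     (normal_density (\<Sum>b\<in>B. 0) (sqrt (\<Sum>b\<in>B. (\<bar>u \<bullet> b\<bar> * s)\<^sup>2)))"
    by (rule sum_indep_normal[OF _ ne ind _ d]) (use s in \<open>auto simp: B_def\<close>)
  moreover have "(\<Sum>b\<in>B. (u \<bullet> b) * (e \<bullet> b)) = e \<bullet> u" for e
  proof -
    have "(\<Sum>b\<in>B. (u \<bullet> b) * (e \<bullet> b)) = (\<Sum>b\<in>Basis. (u \<bullet> b) * (e \<bullet> b))"
      by (rule sum.mono_neutral_left) (auto simp: B_def)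
    then show ?thesis by (subst euclidean_inner) (simp add: mult.commute)
  qed
  moreover have "sqrt (\<Sum>b\<in>B. (\<bar>u \<bullet> b\<bar> * s)\<^sup>2) = s"
    using s sq by (simp add: power_mult_distrib flip: sum_distrib_right)
  ultimately show ?thesis by simp
qed

text \<open>Reduces a classifier that sees only one direction to a labelling of the real line;
  moving the centre along that direction only changes the mean \<open>a\<close>.\<close>

lemma measure_isotropic_gaussian_projection:
  fixes u :: "'a::euclidean_space"
  assumes s: "s > 0" and u: "norm u = 1" and S: "S \<in> sets borel"
  shows "measure (isotropic_gaussian s) {e. a + (e \<bullet> u) / s \<in> S} = measure (unit_normal a) S"
proof -
  interpret prob_space "isotropic_gaussian s :: 'a measure"
    using s by (rule prob_space_isotropic_gaussian)
  have "distributed (isotropic_gaussian s) lborel (\<lambda>e. a + (1 / s) * (e \<bullet> u)) (normal_density a 1)"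
    using normal_density_affine[OF distributed_isotropic_gaussian_inner[OF s u] s, of "1 / s" a] s
    by simp
  then have "measure (unit_normal a) S =
      measure (distr (isotropic_gaussian s) lborel (\<lambda>e. a + (1 / s) * (e \<bullet> u))) S"
    by (simp add: distributed_distr_eq_density)
  also have "\<dots> = measure (isotropic_gaussian s) {e. a + (e \<bullet> u) / s \<in> S}"
    using S by (subst measure_distr) (auto simp: vimage_def)
  finally show ?thesis by simp
qed

section \<open>Labelling the sets of a chain\<close>

text \<open>
  Greedy cutting, starting with the largest value $p_k$: remove a slab $E(a + p_k) \setminus E(a)$ of
  \<open>N\<close>-mass exactly \<open>q\<close> (or the outermost slab, if even that one has mass at least \<open>q\<close>). As
  $p_k \ge p_{t+1}$, a set of the old chain that represents the $t$-th partial sum in the new one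
  contains the old set of the $(t+1)$-st partial sum, so the lower bounds on the \<open>N\<close>-masses persist.
\<close>

lemma chain_labelling_exact:
  fixes p :: "nat \<Rightarrow> real" and E :: "real \<Rightarrow> 'a set" and G :: "real \<Rightarrow> real"
  assumes "finite_measure M" "finite_measure N" "sets N = sets M"
    and "\<And>j. j \<in> {1..k} \<Longrightarrow> 0 \<le> p j"
    and "\<And>i j. i \<in> {1..k} \<Longrightarrow> j \<in> {1..k} \<Longrightarrow> i \<le> j \<Longrightarrow> p i \<le> p j"
    and "\<And>m m'. 0 \<le> m \<Longrightarrow> m \<le> m' \<Longrightarrow> m' \<le> (\<Sum>j=1..k. p j) \<Longrightarrow> E m \<subseteq> E m'"
    and "\<And>m. m \<in> {0..(\<Sum>j=1..k. p j)} \<Longrightarrow> E m \<in> sets M"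
    and "\<And>m. m \<in> {0..(\<Sum>j=1..k. p j)} \<Longrightarrow> measure M (E m) = m"
    and "\<And>m. m \<in> {0..(\<Sum>j=1..k. p j)} \<Longrightarrow> measure N (E m) = G m"
    and "continuous_on {0..(\<Sum>j=1..k. p j)} G" and "E 0 = {}"
    and "\<And>t. t \<in> {1..k} \<Longrightarrow> real t * q \<le> G (\<Sum>j=1..t. p j)"
  shows "\<exists>h. h \<in> M \<rightarrow>\<^sub>M count_space (UNIV :: nat set) \<and>
     (\<forall>x\<in>E (\<Sum>j=1..k. p j). h x \<in> {1..k}) \<and>
     (\<forall>j\<in>{1..k}. measure M {x \<in> E (\<Sum>j=1..k. p j). h x = j} = p j \<and>
                  q \<le> measure N {x \<in> E (\<Sum>j=1..k. p j). h x = j})"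
  using assms(4-)
proof (induction k arbitrary: E G)
  case 0
  then show ?case by (intro exI[of _ "\<lambda>_. 0"]) simp
next
  case (Suc k)
  interpret M: finite_measure M by fact
  interpret N: finite_measure N by fact
  note [simp] = \<open>sets N = sets M\<close>
  define P where "P t = (\<Sum>j=1..t. p j)" for t
  define r where "r = p (Suc k)"
  note prems = Suc.prems[folded P_def]
  have PS: "P (Suc k) = P k + r" by (simp add: P_def r_def)
  have r0: "0 \<le> r" using prems(1) by (simp add: r_def)
  have Pmono: "P s \<le> P t" if "s \<le> t" "t \<le> Suc k" for s t
    unfolding P_def using that prems(1) by (intro sum_mono2) auto
  have P0: "0 \<le> P t" if "t \<le> Suc k" for t using Pmono[of 0 t] that by (simp add: P_def)
  have Pstep: "P (Suc t) \<le> P t + r" if "t \<le> k" for t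
    using prems(2)[of "Suc t" "Suc k"] that by (simp add: P_def r_def)
  have Gmono: "G m \<le> G m'" if "0 \<le> m" "m \<le> m'" "m' \<le> P (Suc k)" for m m'
  proof -
    have "measure N (E m) \<le> measure N (E m')"
      using prems(3)[of m m'] prems(4)[of m'] that by (intro N.finite_measure_mono) auto
    then show ?thesis using prems(6)[of m] prems(6)[of m'] that by simp
  qed
  \<comment> \<open>\<open>a\<close> is the lower end of the slab for the largest value
    \<open>r\<close>. Exact mass \<open>q\<close> matters only if \<open>a < P k\<close>, since only
    then can a partial sum of the remaining values exceed \<open>a\<close>.\<close>
  obtain a where a: "a \<in> {0..P k}" "q \<le> G (a + r) - G a"
      "a < P k \<Longrightarrow> G (a + r) - G a = q"
  proof (cases "q \<le> G (P k + r) - G (P k)")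
    case True
    then show ?thesis using that[of "P k"] P0[of k] by simp
  next
    case False
    define \<phi> where "\<phi> = (\<lambda>m. G (m + r) - G m)"
    \<comment> \<open>At lower end 0 the slab is \<open>E r\<close>, which contains
      \<open>E (P 1)\<close> because \<open>r\<close> is at least \<open>p 1\<close>. So the slab
      mass passes from at least \<open>q\<close> to below \<open>q\<close>, and the intermediate
      value theorem applies.\<close>
    have "q \<le> G (P 1)" using prems(9)[of 1] by simp
    also have "\<dots> \<le> G r" using Gmono[of "P 1" r] P0[of 1] P0[of k] Pstep[of 0] PS
      by (simp add: P_def)
    finally have 1: "q \<le> \<phi> 0" using prems(6)[of 0] prems(8) P0[of "Suc k"] by (simp add: \<phi>_def)
    have 2: "\<phi> (P k) \<le> q" using False by (simp add: \<phi>_def)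
    have "continuous_on {0..P k} (\<lambda>m. G (m + r))"
      by (rule continuous_on_compose2[OF prems(7)]) (use r0 PS in \<open>auto intro!: continuous_intros\<close>)
    moreover have "continuous_on {0..P k} G"
      using prems(7) by (rule continuous_on_subset) (use r0 PS in auto)
    ultimately have 3: "continuous_on {0..P k} \<phi>"
      unfolding \<phi>_def by (intro continuous_intros)
    obtain a where "0 \<le> a" "a \<le> P k" "\<phi> a = q"
      using IVT2'[OF 2 1 P0 3] by auto
    then show ?thesis using that[of a] by (simp add: \<phi>_def)
  qed
  define D where "D = E (a + r) - E a"
  \<comment> \<open>The chain with the slab taken out. Above \<open>a\<close> the index is shifted
    by \<open>r\<close> to compensate for the lost mass, so \<open>E' m\<close> again has
    \<open>M\<close>-mass \<open>m\<close>; the two branches agree at \<open>a\<close>.\<close>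
  define E' where "E' = (\<lambda>m. if m \<le> a then E m else E (m + r) - D)"
  define G' where "G' = (\<lambda>m. if m \<le> a then G m else G (m + r) - (G (a + r) - G a))"
  have aE: "E a \<subseteq> E (a + r)" "E a \<in> sets M" "E (a + r) \<in> sets M"
    using prems(3,4) a(1) r0 PS by auto
  have DM: "D \<in> sets M" using aE by (simp add: D_def)
  have MD: "measure M D = r"
    unfolding D_def using aE prems(5)[of a] prems(5)[of "a + r"] a(1) r0 PS
    by (subst M.finite_measure_Diff) auto
  have ND: "measure N D = G (a + r) - G a"
    unfolding D_def using aE prems(6)[of a] prems(6)[of "a + r"] a(1) r0 PS
    by (subst N.finite_measure_Diff) auto
  have DE: "D \<subseteq> E (m + r)" if "a \<le> m" "m \<le> P k" for m
    using prems(3)[of "a + r" "m + r"] that a(1) r0 PS by (auto simp: D_def)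
  have IH: "\<exists>h. h \<in> M \<rightarrow>\<^sub>M count_space (UNIV :: nat set) \<and>
     (\<forall>x\<in>E' (P k). h x \<in> {1..k}) \<and>
     (\<forall>j\<in>{1..k}. measure M {x \<in> E' (P k). h x = j} = p j \<and>
                  q \<le> measure N {x \<in> E' (P k). h x = j})"
  proof (rule Suc.IH[where E = E' and G = G', folded P_def])
    show "0 \<le> p j" if "j \<in> {1..k}" for j using that prems(1) by simp
    show "p i \<le> p j" if "i \<in> {1..k}" "j \<in> {1..k}" "i \<le> j" for i j using that prems(2) by simp
    show "E' m \<subseteq> E' m'" if mm: "0 \<le> m" "m \<le> m'" "m' \<le> P k" for m m'
    proof (cases "m' \<le> a")
      case True
      then show ?thesis using mm prems(3)[of m m'] r0 PS by (simp add: E'_def)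
    next
      case m': False
      show ?thesis
      proof (cases "m \<le> a")
        case True
        then have "E m \<subseteq> E a" "E m \<subseteq> E (m' + r)" using mm prems(3) a(1) r0 PS by auto
        then show ?thesis using True m' by (auto simp: E'_def D_def)
      next
        case False
        then have "E (m + r) \<subseteq> E (m' + r)" using mm prems(3) r0 PS by auto
        then show ?thesis using False m' by (auto simp: E'_def)
      qed
    qed
    show "E' m \<in> sets M" if "m \<in> {0..P k}" for m
      using that prems(4)[of m] prems(4)[of "m + r"] DM r0 PS by (auto simp: E'_def)
    show "measure M (E' m) = m" if "m \<in> {0..P k}" for m
    proof (cases "m \<le> a")
      case True
      then show ?thesis using that prems(5)[of m] r0 PS by (simp add: E'_def)
    next
      case False
      have "measure M (E (m + r) - D) = m"
        using that prems(5)[of "m + r"] prems(4)[of "m + r"] DM DE[of m] False MD r0 PS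
        by (subst M.finite_measure_Diff) auto
      then show ?thesis using False by (simp add: E'_def)
    qed
    show "measure N (E' m) = G' m" if "m \<in> {0..P k}" for m
    proof (cases "m \<le> a")
      case True
      then show ?thesis using that prems(6)[of m] r0 PS by (simp add: E'_def G'_def)
    next
      case False
      have "measure N (E (m + r) - D) = G (m + r) - (G (a + r) - G a)"
        using that prems(6)[of "m + r"] prems(4)[of "m + r"] DM DE[of m] False ND r0 PS
        by (subst N.finite_measure_Diff) auto
      then show ?thesis using False by (simp add: E'_def G'_def)
    qed
    show "continuous_on {0..P k} G'"
    proof -
      have 1: "continuous_on {0..a} G"
        using prems(7) by (rule continuous_on_subset) (use a(1) r0 PS in auto)
      have "continuous_on {a..P k} (\<lambda>m. G (m + r))"
        by (rule continuous_on_compose2[OF prems(7)])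
           (use a(1) r0 PS in \<open>auto intro!: continuous_intros\<close>)
      then have 2: "continuous_on {a..P k} (\<lambda>m. G (m + r) - (G (a + r) - G a))"
        by (intro continuous_intros)
      have "continuous_on ({0..a} \<union> {a..P k}) G'"
        unfolding G'_def by (rule continuous_on_If[OF _ _ 1 2]) auto
      moreover have "{0..a} \<union> {a..P k} = {0..P k}" using a(1) by auto
      ultimately show ?thesis by simp
    qed
    show "E' 0 = {}" using a(1) prems(8) by (simp add: E'_def)
    show "real t * q \<le> G' (P t)" if t: "t \<in> {1..k}" for t
    proof (cases "P t \<le> a")
      case True
      then show ?thesis using prems(9)[of t] t by (simp add: G'_def)
    next
      case False
      \<comment> \<open>Removing the slab costs exactly \<open>q\<close>, but \<open>P t + r\<close>
        is at least \<open>P (Suc t)\<close>, whose set had \<open>N\<close>-mass at least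
        \<open>Suc t\<close> times \<open>q\<close>. Thus \<open>t\<close> times \<open>q\<close>
        remains.\<close>
      then have "a < P k" using Pmono[of t k] t by simp
      then have eq: "G (a + r) - G a = q" using a(3) by simp
      have "real (Suc t) * q \<le> G (P (Suc t))" using prems(9)[of "Suc t"] t by simp
      also have "\<dots> \<le> G (P t + r)"
        using Gmono[of "P (Suc t)" "P t + r"] Pstep[of t] P0[of "Suc t"] Pmono[of t k] PS t by simp
      finally show ?thesis using False eq by (simp add: G'_def algebra_simps)
    qed
  qed
  then obtain h where h[measurable]: "h \<in> M \<rightarrow>\<^sub>M count_space (UNIV :: nat set)"
    and hr: "\<And>x. x \<in> E' (P k) \<Longrightarrow> h x \<in> {1..k}"
    and hj: "\<And>j. j \<in> {1..k} \<Longrightarrow> measure M {x \<in> E' (P k). h x = j} = p j"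
      "\<And>j. j \<in> {1..k} \<Longrightarrow> q \<le> measure N {x \<in> E' (P k). h x = j}"
    by blast
  \<comment> \<open>If the slab is outermost, then \<open>a = P k\<close> and
    \<open>E' (P k)\<close> falls under the unshifted branch; it is still everything except the
    slab.\<close>
  have E'k: "E' (P k) = E (P (Suc k)) - D"
  proof (cases "P k \<le> a")
    case True
    then have "a = P k" using a(1) by simp
    then show ?thesis using aE(1) by (auto simp: E'_def D_def PS)
  qed (simp add: E'_def PS)
  have Dsub: "D \<subseteq> E (P (Suc k))" using DE[of "P k"] a(1) PS by simp
  define h' where "h' = (\<lambda>x. if x \<in> D then Suc k else h x)"
  have "h' \<in> M \<rightarrow>\<^sub>M count_space UNIV"
    unfolding h'_def using DM by measurable
  moreover have "\<forall>x\<in>E (P (Suc k)). h' x \<in> {1..Suc k}"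
    using hr by (force simp: h'_def E'k)
  moreover have "measure M {x \<in> E (P (Suc k)). h' x = j} = p j \<and>
                  q \<le> measure N {x \<in> E (P (Suc k)). h' x = j}" if j: "j \<in> {1..Suc k}" for j
  proof (cases "j = Suc k")
    case True
    have "{x \<in> E (P (Suc k)). h' x = j} = D"
      using True Dsub hr by (force simp: h'_def E'k)
    then show ?thesis using MD ND a(2) True by (simp add: r_def)
  next
    case False
    then have "{x \<in> E (P (Suc k)). h' x = j} = {x \<in> E' (P k). h x = j}"
      by (auto simp: h'_def E'k)
    then show ?thesis using hj[of j] j False by simp
  qed
  ultimately show ?case unfolding P_def by blast
qed

text \<open>Each label in turn takes the outermost slab, of mass at most \<open>w i\<close>, until
  nothing is left; the total capacity suffices. This fills the gap between the two tails.\<close>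

lemma chain_labelling_bounded:
  fixes w :: "'i \<Rightarrow> real" and E :: "real \<Rightarrow> 'a set"
  assumes "finite_measure M" "finite I"
    and "\<And>i. i \<in> I \<Longrightarrow> 0 \<le> w i"
    and "\<And>m m'. a \<le> m \<Longrightarrow> m \<le> m' \<Longrightarrow> m' \<le> d \<Longrightarrow> E m \<subseteq> E m'"
    and "\<And>m. m \<in> {a..d} \<Longrightarrow> E m \<in> sets M"
    and "\<And>m. m \<in> {a..d} \<Longrightarrow> measure M (E m) = m"
    and "a \<le> d" and "d - a \<le> (\<Sum>i\<in>I. w i)"
  shows "\<exists>g. g \<in> M \<rightarrow>\<^sub>M count_space UNIV \<and> (\<forall>x\<in>E d - E a. g x \<in> I) \<and>
     (\<forall>i\<in>I. measure M {x \<in> E d - E a. g x = i} \<le> w i)"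
  using assms(2-)
proof (induction I arbitrary: d)
  case empty
  then have "d = a" by simp
  then show ?case by (intro exI[of _ "\<lambda>_. undefined"]) simp
next
  case (insert i I)
  interpret M: finite_measure M by fact
  note prems = insert.prems
  \<comment> \<open>Lower end of the slab of \<open>i\<close>; the maximum stops it at
    \<open>a\<close> when the capacity of \<open>i\<close> exceeds what is left.\<close>
  define a' where "a' = max a (d - w i)"
  have a': "a \<le> a'" "a' \<le> d" "d - a' \<le> w i"
    using prems(1)[of i] prems(5) by (auto simp: a'_def)
  have "a' - a \<le> (\<Sum>j\<in>I. w j)"
    using prems(6) sum_nonneg[of I w] prems(1) insert.hyps by (auto simp: a'_def)
  then obtain g where g[measurable]: "g \<in> M \<rightarrow>\<^sub>M count_space UNIV"
    and gI: "\<And>x. x \<in> E a' - E a \<Longrightarrow> g x \<in> I"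
    and gw: "\<And>j. j \<in> I \<Longrightarrow> measure M {x \<in> E a' - E a. g x = j} \<le> w j"
    using insert.IH[of a'] prems a' by fastforce
  have sub: "E a' \<subseteq> E d" "E a \<subseteq> E a'" using prems(2) a' by auto
  have sE: "E a' \<in> sets M" "E d \<in> sets M" using prems(3) a' by auto
  have mE: "measure M (E d - E a') \<le> w i"
    using prems(4)[of d] prems(4)[of a'] sub sE a' by (subst M.finite_measure_Diff) auto
  define g' where "g' = (\<lambda>x. if x \<in> E a' then g x else i)"
  have "g' \<in> M \<rightarrow>\<^sub>M count_space UNIV" unfolding g'_def using sE by measurable
  moreover have "\<forall>x\<in>E d - E a. g' x \<in> insert i I" using gI by (auto simp: g'_def)
  moreover have "measure M {x \<in> E d - E a. g' x = j} \<le> w j" if j: "j \<in> insert i I" for j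
  proof (cases "j = i")
    case True
    have "{x \<in> E d - E a. g' x = j} = E d - E a'"
      using True gI insert.hyps sub by (auto simp: g'_def)
    then show ?thesis using mE True by simp
  next
    case False
    then have "{x \<in> E d - E a. g' x = j} = {x \<in> E a' - E a. g x = j}"
      using sub by (auto simp: g'_def)
    then show ?thesis using gw[of j] False j by simp
  qed
  ultimately show ?case by blast
qed

section \<open>The classifier\<close>

theorem theorem2:
  fixes x :: "real ^ 'd"
    and \<sigma> pl R :: real
    and c k l :: nat
    and pbar :: "nat \<Rightarrow> real"
    and b :: "nat \<Rightarrow> nat"
    and \<delta> :: "real ^ 'd"
  assumes "\<sigma> > 0"
    and "1 \<le> k" and "k < c"
    and "l \<in> {1..c}"
    and "pl \<in> {0..1}"
    and "\<forall>i \<in> {1..c} - {l}. pbar i \<in> {0..1}"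
    and "k_largest ({1..c} - {l}) pbar k b"
    and "radius_gap k \<sigma> pl (\<lambda>t. \<Sum>j=1..t. pbar (b j)) R = 0"
    and "\<forall>R'. radius_gap k \<sigma> pl (\<lambda>t. \<Sum>j=1..t. pbar (b j)) R' = 0 \<longrightarrow> R' = R"
    and "pl + (\<Sum>j=1..k. pbar (b j)) \<le> 1"
    and "pl + (\<Sum>i \<in> {1..c} - {l}. pbar i) \<ge> 1"
    and "norm \<delta> > R"
  shows "\<exists>f. f \<in> borel \<rightarrow>\<^sub>M count_space {1..c} \<and>
           label_prob \<sigma> f x l \<ge> pl \<and>
           (\<forall>i \<in> {1..c} - {l}. label_prob \<sigma> f x i \<le> pbar i) \<and>
           (\<forall>G \<in> smoothed_topk c k \<sigma> f (x + \<delta>). l \<notin> G)"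
proof -
  note [simp] = \<open>\<sigma> > 0\<close>
  define P where "P t = (\<Sum>j=1..t. pbar (b j))" for t
  define \<tau> where "\<tau> = norm \<delta> / \<sigma>"
  have b: "inj_on b {1..k}" "b ` {1..k} \<subseteq> {1..c} - {l}"
    "\<And>s t. s \<in> {1..k} \<Longrightarrow> t \<in> {1..k} \<Longrightarrow> s \<le> t \<Longrightarrow> pbar (b s) \<le> pbar (b t)"
    using assms(7) by (auto simp: k_largest_def)
  have pb0: "0 \<le> pbar (b j)" if "j \<in> {1..k}" for j
    using that b(2) assms(6) by (meson atLeastAtMost_iff image_subset_iff)
  have P0: "0 \<le> P t" and Pk: "P t \<le> P k" if "t \<le> k" for t
    unfolding P_def using that by (auto intro!: sum_nonneg sum_mono2 pb0)
  have Pk1: "P k \<le> 1 - pl" using assms(10) by (simp add: P_def)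

  \<comment> \<open>Comparing the two sides of the radius equation beyond R\<close>
  define q where "q = (MIN t\<in>{1..k}. Phi (Phi_inv (P t) + ereal \<tau>) / real t)"
  have q_le: "real t * q \<le> Phi (Phi_inv (P t) + ereal \<tau>)" if "t \<in> {1..k}" for t
  proof -
    have "q \<le> Phi (Phi_inv (P t) + ereal \<tau>) / real t"
      unfolding q_def using that by (intro Min_le) auto
    then show ?thesis using that by (simp add: field_simps)
  qed
  have gap: "Phi (Phi_inv pl - ereal (R / \<sigma>)) =
      (MIN t\<in>{1..k}. Phi (Phi_inv (P t) + ereal (R / \<sigma>)) / real t)"
    using assms(8) by (simp add: radius_gap_def P_def)
  have gap_le: "Phi (Phi_inv pl - ereal (R / \<sigma>)) \<le> Phi (Phi_inv (P t) + ereal (R / \<sigma>)) / real t"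
    if "t \<in> {1..k}" for t
    unfolding gap using that by (intro Min_le) auto
  have pl_pos: "Phi_inv pl \<noteq> -\<infinity>"
  proof
    \<comment> \<open>otherwise every larger radius would solve the equation as well\<close>
    assume inf: "Phi_inv pl = -\<infinity>"
    have "0 = (MIN t\<in>{1..k}. Phi (Phi_inv (P t) + ereal (R / \<sigma>)) / real t)"
      using gap inf by (simp add: Phi_def)
    moreover have "(MIN t\<in>{1..k}. Phi (Phi_inv (P t) + ereal (R / \<sigma>)) / real t)
        \<in> (\<lambda>t. Phi (Phi_inv (P t) + ereal (R / \<sigma>)) / real t) ` {1..k}"
      using assms(2) by (intro Min_in) auto
    ultimately obtain t where t: "t \<in> {1..k}" "Phi (Phi_inv (P t) + ereal (R / \<sigma>)) = Phi (-\<infinity>)"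
      by (auto simp: Phi_0)
    then have "Phi_inv (P t) + ereal (R / \<sigma>) = -\<infinity>" by (metis Phi_inv_Phi)
    \<comment> \<open>A finite shift cannot move an infinite quantile, so the \<open>t\<close>-th
      term vanishes at every radius and \<open>R + 1\<close> becomes a second root.\<close>
    then have Pt: "Phi_inv (P t) = -\<infinity>" by (cases "Phi_inv (P t)") auto
    let ?f = "\<lambda>t. Phi (Phi_inv (P t) + ereal ((R + 1) / \<sigma>)) / real t"
    have "(MIN t\<in>{1..k}. ?f t) \<le> ?f t" using t(1) by (intro Min_le) auto
    then have "(MIN t\<in>{1..k}. ?f t) \<le> 0" using Pt by (simp add: Phi_0)
    moreover have "0 \<le> (MIN t\<in>{1..k}. ?f t)"
      using assms(2) Phi_range by (subst Min_ge_iff) auto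
    ultimately have "radius_gap k \<sigma> pl (\<lambda>t. \<Sum>j=1..t. pbar (b j)) (R + 1) = 0"
      unfolding radius_gap_def P_def[symmetric] using inf by (simp add: Phi_0)
    then show False using assms(9) by fastforce
  qed
  \<comment> \<open>If \<open>pl = 1\<close>, the mass assumption forces \<open>P 1 = 0\<close>, and
    the term \<open>t = 1\<close> of the radius equation would give
    \<open>1 \<le> 0\<close>.\<close>
  have pl_lt1: "Phi_inv pl \<noteq> \<infinity>"
  proof
    assume inf: "Phi_inv pl = \<infinity>"
    then have "pl = 1" using Phi_Phi_inv[OF assms(5)] by (simp add: Phi_1)
    then have "P 1 = 0" using P0[of 1] Pk[of 1] Pk1 assms(2) by simp
    then show False using gap_le[of 1] inf assms(2) by (simp add: Phi_0 Phi_1 Phi_inv_0)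
  qed
  have "R / \<sigma> < \<tau>" unfolding \<tau>_def using assms(12) by (simp add: divide_strict_right_mono)
  \<comment> \<open>Strictness rests on the quantile of \<open>pl\<close> being finite: an infinite
    one would absorb the shift.\<close>
  then have l_less: "Phi (Phi_inv pl - ereal \<tau>) < Phi (Phi_inv pl - ereal (R / \<sigma>))"
    using pl_pos pl_lt1 by (intro Phi_less) (cases "Phi_inv pl"; simp)
  have l_less_q: "Phi (Phi_inv pl - ereal \<tau>) < q"
  proof -
    have "Phi (Phi_inv pl - ereal \<tau>) < Phi (Phi_inv (P t) + ereal \<tau>) / real t" if "t \<in> {1..k}" for t
    proof -
      have "Phi (Phi_inv (P t) + ereal (R / \<sigma>)) \<le> Phi (Phi_inv (P t) + ereal \<tau>)"
        using \<open>R / \<sigma> < \<tau>\<close> by (intro Phi_mono add_left_mono) simp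
      then have "Phi (Phi_inv (P t) + ereal (R / \<sigma>)) / real t \<le> Phi (Phi_inv (P t) + ereal \<tau>) / real t"
        by (rule divide_right_mono) simp
      then show ?thesis using l_less gap_le[OF that] by linarith
    qed
    then show ?thesis unfolding q_def using assms(2) by (subst Min_gr_iff) auto
  qed

  \<comment> \<open>Distributing the labels over upper tails\<close>
  define E where "E m = {y. - Phi_inv m \<le> ereal y}" for m
  have E_sets[measurable]: "E m \<in> sets borel" for m unfolding E_def by measurable
  have E_mono: "E m \<subseteq> E m'" if "0 \<le> m" "m \<le> m'" "m' \<le> 1" for m m'
    using Phi_inv_mono[of m m'] that by (auto simp: E_def intro: order_trans[rotated])
  \<comment> \<open>For \<open>a = \<tau>\<close> the right-hand side is a numerator in the minimum
    \<open>q\<close>, so \<open>q_le\<close> is the growth hypothesis required to cut the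
    tail.\<close>
  have E_measure: "measure (unit_normal a) (E m) = Phi (Phi_inv m + ereal a)" for a m
    by (simp add: E_def measure_unit_normal_ge)
  have E_std: "measure (unit_normal 0) (E m) = m" if "m \<in> {0..1}" for m
    using E_measure[of 0 m] that by (simp add: Phi_Phi_inv flip: zero_ereal_def)
  have fin: "finite_measure (unit_normal a)" for a
    using prob_space_normal_density[of 1 a] by (simp add: prob_space.finite_measure)

  \<comment> \<open>\<open>h\<close> takes positions in the enumeration \<open>b\<close> as values,
    not labels; \<open>F\<close> applies \<open>b\<close> to them later.\<close>
  obtain h where h: "h \<in> unit_normal 0 \<rightarrow>\<^sub>M count_space (UNIV :: nat set)"
    "\<And>j. j \<in> {1..k} \<Longrightarrow> measure (unit_normal 0) {y \<in> E (P k). h y = j} = pbar (b j)"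
    "\<And>j. j \<in> {1..k} \<Longrightarrow> q \<le> measure (unit_normal \<tau>) {y \<in> E (P k). h y = j}"
    "\<And>y. y \<in> E (P k) \<Longrightarrow> h y \<in> {1..k}"
  proof -
    have pos: "0 \<le> m \<and> m \<le> 1" if "m \<in> {0..P k}" for m using that Pk1 assms(5) by auto
    have "\<exists>h. h \<in> unit_normal 0 \<rightarrow>\<^sub>M count_space (UNIV :: nat set) \<and>
       (\<forall>y\<in>E (\<Sum>j=1..k. pbar (b j)). h y \<in> {1..k}) \<and>
       (\<forall>j\<in>{1..k}. measure (unit_normal 0) {y \<in> E (\<Sum>j=1..k. pbar (b j)). h y = j} = pbar (b j) \<and>
          q \<le> measure (unit_normal \<tau>) {y \<in> E (\<Sum>j=1..k. pbar (b j)). h y = j})"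
    proof (rule chain_labelling_exact[OF fin fin, where G = "\<lambda>m. Phi (Phi_inv m + ereal \<tau>)"];
        (unfold P_def[symmetric])?)
      show "continuous_on {0..P k} (\<lambda>m. Phi (Phi_inv m + ereal \<tau>))"
        by (rule continuous_on_subset[OF continuous_on_Phi_shift]) (use pos in auto)
      show "E 0 = {}" by (simp add: E_def Phi_inv_0)
      show "E m \<subseteq> E m'" if "0 \<le> m" "m \<le> m'" "m' \<le> P k" for m m'
        using that pos[of m'] by (intro E_mono) auto
      show "measure (unit_normal 0) (E m) = m" if "m \<in> {0..P k}" for m
        using pos[OF that] by (intro E_std) simp
    qed (simp_all add: pb0 b(3) q_le E_measure)
    then show ?thesis using that unfolding P_def by blast
  qed

  define I where "I = {1..c} - {l} - b ` {1..k}"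
  have "(\<Sum>i\<in>{1..c} - {l}. pbar i) = (\<Sum>i\<in>I. pbar i) + (\<Sum>i\<in>b ` {1..k}. pbar i)"
    unfolding I_def using b(2) by (intro sum.subset_diff) auto
  also have "(\<Sum>i\<in>b ` {1..k}. pbar i) = P k"
    unfolding P_def using b(1) by (simp add: sum.reindex)
  \<comment> \<open>The assumption that all bounds add up to at least 1 says that the remaining
    labels can absorb the gap of mass \<open>1 - pl - P k\<close>.\<close>
  finally have rest: "1 - pl - P k \<le> (\<Sum>i\<in>I. pbar i)" using assms(11) by simp
  have "\<exists>g. g \<in> unit_normal 0 \<rightarrow>\<^sub>M count_space UNIV \<and> (\<forall>y\<in>E (1 - pl) - E (P k). g y \<in> I) \<and>
     (\<forall>i\<in>I. measure (unit_normal 0) {y \<in> E (1 - pl) - E (P k). g y = i} \<le> pbar i)"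
  proof (rule chain_labelling_bounded[OF fin])
    have pos: "0 \<le> m \<and> m \<le> 1" if "P k \<le> m" "m \<le> 1 - pl" for m
      using that P0[of k] assms(5) by auto
    show "0 \<le> pbar i" if "i \<in> I" for i using that assms(6) by (auto simp: I_def)
    show "E m \<subseteq> E m'" if "P k \<le> m" "m \<le> m'" "m' \<le> 1 - pl" for m m'
      using that pos[of m] pos[of m'] by (intro E_mono) auto
    show "measure (unit_normal 0) (E m) = m" if "m \<in> {P k..1 - pl}" for m
      using that pos[of m] by (intro E_std) auto
  qed (use Pk1 rest in \<open>simp_all add: I_def\<close>)
  then obtain g where g: "g \<in> unit_normal 0 \<rightarrow>\<^sub>M count_space UNIV"
    "\<And>y. y \<in> E (1 - pl) \<Longrightarrow> y \<notin> E (P k) \<Longrightarrow> g y \<in> I"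
    "\<And>i. i \<in> I \<Longrightarrow> measure (unit_normal 0) {y \<in> E (1 - pl) - E (P k). g y = i} \<le> pbar i"
    by blast
  have [measurable]: "h \<in> borel \<rightarrow>\<^sub>M count_space UNIV" "g \<in> borel \<rightarrow>\<^sub>M count_space UNIV"
    using h(1) g(1) by (simp_all add: measurable_def)

  \<comment> \<open>The labelling of the real line\<close>
  define F where "F y = (if y \<in> E (P k) then b (h y) else if y \<in> E (1 - pl) then g y else l)" for y
  have F_meas[measurable]: "F \<in> borel \<rightarrow>\<^sub>M count_space UNIV" unfolding F_def by measurable
  have hb: "b (h y) \<in> {1..c} - {l} \<and> b (h y) \<notin> I" if "y \<in> E (P k)" for y
    using h(4)[OF that] b(2) unfolding I_def by blast
  have gI: "g y \<in> {1..c} \<and> g y \<noteq> l \<and> g y \<notin> b ` {1..k}" if "y \<in> E (1 - pl)" "y \<notin> E (P k)" for y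
    using g(2)[OF that] unfolding I_def by blast
  have F_range: "F y \<in> {1..c}" for y
    using hb[of y] gI[of y] assms(4) by (simp add: F_def)
  \<comment> \<open>The tails of \<open>l\<close> and of the labels \<open>b j\<close> do not
    overlap because \<open>pl + P k \<le> 1\<close>; hence \<open>l\<close> gets exactly the
    complement of \<open>E (1 - pl)\<close>.\<close>
  have EP: "E (P k) \<subseteq> E (1 - pl)" using P0[of k] Pk1 assms(5) by (intro E_mono) auto
  have F_l: "{y. F y = l} = UNIV - E (1 - pl)"
  proof -
    have "F y = l \<longleftrightarrow> y \<notin> E (1 - pl)" for y
      using hb[of y] gI[of y] EP[THEN subsetD, of y]
      by (cases "y \<in> E (P k)"; cases "y \<in> E (1 - pl)") (simp_all add: F_def)
    then show ?thesis by blast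
  qed
  have F_b: "{y. F y = b j} = {y \<in> E (P k). h y = j}" if j: "j \<in> {1..k}" for j
  proof -
    have "b (h y) = b j \<longleftrightarrow> h y = j" if "y \<in> E (P k)" for y
      using inj_on_eq_iff[OF b(1) h(4)[OF that] j] .
    moreover have "b j \<noteq> l" using b(2) j by blast
    moreover have "g y \<noteq> b j" if "y \<in> E (1 - pl)" "y \<notin> E (P k)" for y
      using gI[OF that] j by blast
    ultimately have "F y = b j \<longleftrightarrow> y \<in> E (P k) \<and> h y = j" for y
      by (cases "y \<in> E (P k)"; cases "y \<in> E (1 - pl)") (simp_all add: F_def)
    then show ?thesis by blast
  qed
  have F_I: "{y. F y = i} = {y \<in> E (1 - pl) - E (P k). g y = i}" if "i \<in> I" for i
  proof -
    have "i \<noteq> l" using that by (simp add: I_def)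
    then have "F y = i \<longleftrightarrow> y \<in> E (1 - pl) - E (P k) \<and> g y = i" for y
      using that hb[of y] by (cases "y \<in> E (P k)"; cases "y \<in> E (1 - pl)") (auto simp: F_def)
    then show ?thesis by blast
  qed

  \<comment> \<open>Transfer to the Euclidean space\<close>
  define u :: "real ^ 'd" where "u = (if \<delta> = 0 then axis undefined 1 else \<delta> /\<^sub>R norm \<delta>)"
  \<comment> \<open>The case \<open>\<delta> = 0\<close> can occur when \<open>R\<close> is
    negative; any unit vector then satisfies both equations.\<close>
  have u: "norm u = 1" "\<delta> \<bullet> u = norm \<delta>"
    by (auto simp: u_def norm_axis_1 dot_square_norm power2_eq_square)
  define f where "f z = F (((z - x) \<bullet> u) / \<sigma>)" for z
  \<comment> \<open>Centring the noise at \<open>x + v\<close> moves the mean of the projected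
    coordinate to \<open>(v \<bullet> u) / \<sigma>\<close>: 0 for \<open>v = 0\<close>, and
    \<open>\<tau>\<close> for \<open>v = \<delta>\<close>.\<close>
  have lp: "label_prob \<sigma> f (x + v) i = measure (unit_normal ((v \<bullet> u) / \<sigma>)) {y. F y = i}" for v i
  proof -
    have "{y. F y = i} \<in> sets borel" by measurable
    from measure_isotropic_gaussian_projection[OF \<open>\<sigma> > 0\<close> u(1) this, of "(v \<bullet> u) / \<sigma>"]
    show ?thesis
      by (simp add: label_prob_def f_def inner_add_left add_divide_distrib)
  qed
  have lpx: "label_prob \<sigma> f x i = measure (unit_normal 0) {y. F y = i}" for i
    using lp[of 0] by simp
  have lpd: "label_prob \<sigma> f (x + \<delta>) i = measure (unit_normal \<tau>) {y. F y = i}" for i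
    using lp[of \<delta>] by (simp add: u \<tau>_def)
  have l_prob: "measure (unit_normal a) {y. F y = l} = Phi (Phi_inv pl - ereal a)" for a
  proof -
    have "{y. F y = l} = {y. ereal y < Phi_inv pl}"
      using assms(5) unfolding F_l E_def by (auto simp: Phi_inv_one_minus)
    then show ?thesis by (simp add: measure_unit_normal_less)
  qed
  show ?thesis
  proof (intro exI[of _ f] conjI ballI)
    have "f \<in> borel \<rightarrow>\<^sub>M count_space UNIV" unfolding f_def by measurable
    then show "f \<in> borel \<rightarrow>\<^sub>M count_space {1..c}"
      using F_range by (auto simp: measurable_count_space_eq2 f_def measurable_def)
    show "pl \<le> label_prob \<sigma> f x l"
      using l_prob[of 0] assms(5) by (simp add: lpx Phi_Phi_inv flip: zero_ereal_def)
    show "label_prob \<sigma> f x i \<le> pbar i" if i: "i \<in> {1..c} - {l}" for i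
    proof (cases "i \<in> I")
      case True
      then show ?thesis using g(3) by (simp add: lpx F_I)
    next
      case False
      then obtain j where "j \<in> {1..k}" "i = b j" using i by (auto simp: I_def)
      then show ?thesis using h(2) by (simp add: lpx F_b)
    qed
    show "l \<notin> G" if "G \<in> smoothed_topk c k \<sigma> f (x + \<delta>)" for G
    proof
      assume "l \<in> G"
      have G: "G \<subseteq> {1..c}" "card G = k"
        "\<And>i j. i \<in> G \<Longrightarrow> j \<in> {1..c} - G \<Longrightarrow> label_prob \<sigma> f (x + \<delta>) j \<le> label_prob \<sigma> f (x + \<delta>) i"
        using that by (auto simp: smoothed_topk_def)
      have "finite G" using G(1) by (rule finite_subset) simp
      \<comment> \<open>Pigeonhole: \<open>G\<close> has only \<open>k\<close> elements and one of
        them is \<open>l\<close>, so some \<open>b j\<close> is missing. However ties are broken,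
        that \<open>b j\<close> could then be at most as probable as \<open>l\<close>, contrary to
        \<open>l_less_q\<close>.\<close>
      have "\<not> b ` {1..k} \<subseteq> G"
      proof
        assume sub: "b ` {1..k} \<subseteq> G"
        then have "b ` {1..k} = G"
          using card_subset_eq[OF \<open>finite G\<close> sub] b(1) G(2) by (simp add: card_image)
        then show False using \<open>l \<in> G\<close> b(2) by auto
      qed
      then obtain j where j: "j \<in> {1..k}" "b j \<notin> G" by blast
      have "b j \<in> {1..c} - G" using j b(2) by blast
      from G(3)[OF \<open>l \<in> G\<close> this] have "q \<le> Phi (Phi_inv pl - ereal \<tau>)"
        using h(3)[OF j(1)] by (simp add: lpd l_prob F_b[OF j(1)])
      then show False using l_less_q by simp
    qed
  qed
qed

end
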